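(* Let $X$ be a topological space. The following are equivalent. (1) $X$ is homeomorphic to $\mathrm{spec}(M)$ for some finite commutative monoid $M$. (2) $X$ is homeomorphic to $\mathrm{spec}(M)$ for some finitely generated commutative monoid $M$. (3) $X$ is homeomorphic to the underlying space of $E(Y,B)$ for some finite $T_0$ space $Y$ with a monoidal base $B$.
   Context: Kato spectrum: let $M$ be a commutative monoid with unit $1$. A subset $I \subset M$ (possibly empty) is an ideal if $xm \in I$ for all $x \in I$, $m \in M$. An ideal $p$ is prime if $M \setminus p$ is a submonoid of $M$ (in particular $1 \in M \setminus p$). $\mathrm{spec}(M)$ is the set of all prime ideals of $M$, with the topology having as base the sets $D(f) = \{p \in \mathrm{spec}(M) : f \notin p\}$, $f \in M$. Monoidal base: a base $B$ of open sets of a topological space $Y$ is monoidal if $Y \in B$ and $B$ is closed under finite intersections. Exponential $E(Y,B)$: for a $T_0$ space $Y$ with monoidal base $B$, give the power set $\mathcal{P}(Y)$ the topology with base $\{\mathcal{P}(U) : U \in B\}$, and let $A \sim A'$ if and only if $A$ and $A'$ belong to the same open sets of $\mathcal{P}(Y)$. Then $E(Y,B)$ is the quotient space $\mathcal{P}(Y)/\sim$ equipped with the monoidal base $\{\widetilde{U} : U \in B\}$, where $\widetilde{U} = \{[A] \in \mathcal{P}(Y)/\sim \; : A \subset U\}$ and $[A]$ denotes the equivalence class of $A$. Its underlying space is the topological space $\mathcal{P}(Y)/\sim$. *)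

theory Defs
  imports
    "HOL-Analysis.Analysis"
    "HOL-Algebra.Group"
    "HOL-Library.Infinite_Typeclass"
begin

text \<open>
  HOL cannot quantify existentially over types. A statement asserting that some finite or finitely
  generated monoid, or some finite space, exists therefore has to place the witness in a fixed
  carrier type. Finitely generated commutative monoids are countable, so every such object is
  isomorphic (or homeomorphic) to one inside any given infinite type: class \<^class>\<open>infinite\<close> on the
  carrier type entails no loss of generality.
\<close>

section \<open>The Kato spectrum of a commutative monoid\<close>

definition monoid_ideal :: "('m, 'b) monoid_scheme \<Rightarrow> 'm set \<Rightarrow> bool" where
  "monoid_ideal M I \<longleftrightarrow> I \<subseteq> carrier M \<and> (\<forall>x\<in>I. \<forall>m\<in>carrier M. x \<otimes>\<^bsub>M\<^esub> m \<in> I)"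

definition monoid_prime_ideal :: "('m, 'b) monoid_scheme \<Rightarrow> 'm set \<Rightarrow> bool" where
  "monoid_prime_ideal M p \<longleftrightarrow> monoid_ideal M p \<and> submonoid (carrier M - p) M"

definition spec_basic_open :: "('m, 'b) monoid_scheme \<Rightarrow> 'm \<Rightarrow> 'm set set" where
  "spec_basic_open M f = {p. monoid_prime_ideal M p \<and> f \<notin> p}"

text \<open>
  The sets \<open>spec_basic_open M f\<close> are closed under binary intersections when \<open>M\<close> is a commutative
  monoid, so they form the base of a topology, and \<open>topology\<close> is applied to a genuine system of
  open sets (see \<open>openin_kato_spec\<close> below).
\<close>

definition kato_spec :: "('m, 'b) monoid_scheme \<Rightarrow> 'm set topology" where
  "kato_spec M = topology (arbitrary union_of (\<lambda>U. U \<in> spec_basic_open M ` carrier M))"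

lemma monoid_prime_ideal_mult_iff:
  assumes "comm_monoid M" "monoid_prime_ideal M p" "f \<in> carrier M" "g \<in> carrier M"
  shows "f \<otimes>\<^bsub>M\<^esub> g \<notin> p \<longleftrightarrow> f \<notin> p \<and> g \<notin> p"
proof -
  interpret comm_monoid M by fact
  have I: "\<And>x m. x \<in> p \<Longrightarrow> m \<in> carrier M \<Longrightarrow> x \<otimes>\<^bsub>M\<^esub> m \<in> p"
    using assms(2) by (auto simp: monoid_prime_ideal_def monoid_ideal_def)
  have S: "\<And>x y. x \<in> carrier M - p \<Longrightarrow> y \<in> carrier M - p \<Longrightarrow> x \<otimes>\<^bsub>M\<^esub> y \<in> carrier M - p"
    using assms(2) submonoid.m_closed[of "carrier M - p" M] by (simp add: monoid_prime_ideal_def)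
  show ?thesis
    using I[of f g] I[of g f] S[of f g] assms(3,4) m_comm[of f g] by auto
qed

lemma spec_basic_open_Int:
  assumes "comm_monoid M" "f \<in> carrier M" "g \<in> carrier M"
  shows "spec_basic_open M f \<inter> spec_basic_open M g = spec_basic_open M (f \<otimes>\<^bsub>M\<^esub> g)"
  using monoid_prime_ideal_mult_iff[OF assms(1) _ assms(2,3)] by (auto simp: spec_basic_open_def)

lemma spec_basic_open_one:
  "spec_basic_open M \<one>\<^bsub>M\<^esub> = {p. monoid_prime_ideal M p}"
proof -
  have "\<one>\<^bsub>M\<^esub> \<notin> p" if "monoid_prime_ideal M p" for p
    using that submonoid.one_closed[of "carrier M - p" M] by (simp add: monoid_prime_ideal_def)
  then show ?thesis
    by (auto simp: spec_basic_open_def)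
qed

lemma openin_kato_spec:
  assumes "comm_monoid M"
  shows "openin (kato_spec M) = arbitrary union_of (\<lambda>U. U \<in> spec_basic_open M ` carrier M)"
proof -
  interpret comm_monoid M by fact
  have "istopology (arbitrary union_of (\<lambda>U. U \<in> spec_basic_open M ` carrier M))"
    by (rule istopology_base) (auto simp: spec_basic_open_Int[OF assms])
  then show ?thesis
    by (simp add: kato_spec_def)
qed

lemma topspace_kato_spec:
  assumes "comm_monoid M"
  shows "topspace (kato_spec M) = {p. monoid_prime_ideal M p}"
proof -
  interpret comm_monoid M by fact
  have "openin (kato_spec M) {p. monoid_prime_ideal M p}"
    using spec_basic_open_one[of M]
    by (auto simp: openin_kato_spec[OF assms] intro!: arbitrary_union_of_inc)
  moreover have "U \<subseteq> {p. monoid_prime_ideal M p}" if "openin (kato_spec M) U" for U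
    using that
    by (force simp: openin_kato_spec[OF assms] union_of_def arbitrary_def spec_basic_open_def)
  ultimately show ?thesis
    by (meson openin_subset openin_topspace subset_antisym)
qed

definition finitely_generated_monoid :: "('m, 'b) monoid_scheme \<Rightarrow> bool" where
  "finitely_generated_monoid M \<longleftrightarrow>
     (\<exists>A. finite A \<and> A \<subseteq> carrier M \<and> (\<lambda>H. submonoid H M) hull A = carrier M)"

section \<open>Monoidal bases and the exponential\<close>

definition monoidal_base :: "'y topology \<Rightarrow> 'y set set \<Rightarrow> bool" where
  "monoidal_base Y B \<longleftrightarrow>
     openin Y = arbitrary union_of (\<lambda>U. U \<in> B) \<and>
     topspace Y \<in> B \<and> (\<forall>U\<in>B. \<forall>V\<in>B. U \<inter> V \<in> B)"

text \<open>
  \<open>Y\<close> need not be an argument below: it is the largest member of a monoidal base \<open>B\<close>, so the points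
  of \<open>powerset_topology B\<close> are exactly the subsets of \<open>Y\<close> (see \<open>topspace_powerset_topology\<close>).
\<close>

definition powerset_topology :: "'y set set \<Rightarrow> 'y set topology" where
  "powerset_topology B = topology (arbitrary union_of (\<lambda>W. W \<in> Pow ` B))"

lemma openin_powerset_topology:
  assumes "monoidal_base Y B"
  shows "openin (powerset_topology B) = arbitrary union_of (\<lambda>W. W \<in> Pow ` B)"
proof -
  have "istopology (arbitrary union_of (\<lambda>W. W \<in> Pow ` B))"
    using assms by (intro istopology_base) (auto simp: monoidal_base_def simp flip: Pow_Int_eq)
  then show ?thesis
    by (simp add: powerset_topology_def)
qed

lemma topspace_powerset_topology:
  assumes "monoidal_base Y B"
  shows "topspace (powerset_topology B) = Pow (topspace Y)"
proof -
  have B: "U \<subseteq> topspace Y" if "U \<in> B" for U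
    using assms that openin_subset arbitrary_union_of_inc
    by (metis (mono_tags, lifting) monoidal_base_def)
  have "openin (powerset_topology B) (Pow (topspace Y))"
    using assms
    by (auto simp: openin_powerset_topology[OF assms] monoidal_base_def
             intro!: arbitrary_union_of_inc)
  moreover have "W \<subseteq> Pow (topspace Y)" if "openin (powerset_topology B) W" for W
    using that B
    by (force simp: openin_powerset_topology[OF assms] union_of_def arbitrary_def)
  ultimately show ?thesis
    by (meson openin_subset openin_topspace subset_antisym)
qed

definition same_opens :: "'a topology \<Rightarrow> ('a \<times> 'a) set" where
  "same_opens X = {(x, y). x \<in> topspace X \<and> y \<in> topspace X \<and>
                     (\<forall>W. openin X W \<longrightarrow> (x \<in> W \<longleftrightarrow> y \<in> W))}"

lemma equiv_same_opens: "equiv (topspace X) (same_opens X)"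
  by (auto simp: same_opens_def equiv_def refl_on_def sym_def trans_def)

definition quotient_topology :: "'a topology \<Rightarrow> ('a \<times> 'a) set \<Rightarrow> 'a set topology" where
  "quotient_topology X r =
     topology (\<lambda>V. V \<subseteq> topspace X // r \<and> openin X {x \<in> topspace X. r `` {x} \<in> V})"

lemma openin_quotient_topology:
  "openin (quotient_topology X r) V \<longleftrightarrow>
     V \<subseteq> topspace X // r \<and> openin X {x \<in> topspace X. r `` {x} \<in> V}"
proof -
  have "istopology (\<lambda>V. V \<subseteq> topspace X // r \<and> openin X {x \<in> topspace X. r `` {x} \<in> V})"
    unfolding istopology_def
  proof (intro conjI allI impI)
    fix S T
    assume "S \<subseteq> topspace X // r \<and> openin X {x \<in> topspace X. r `` {x} \<in> S}"
      and "T \<subseteq> topspace X // r \<and> openin X {x \<in> topspace X. r `` {x} \<in> T}"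
    moreover have "{x \<in> topspace X. r `` {x} \<in> S \<inter> T} =
        {x \<in> topspace X. r `` {x} \<in> S} \<inter> {x \<in> topspace X. r `` {x} \<in> T}" by auto
    ultimately show "S \<inter> T \<subseteq> topspace X // r"
      and "openin X {x \<in> topspace X. r `` {x} \<in> S \<inter> T}" by (auto simp only: openin_Int)
  next
    fix K
    assume K: "\<forall>V\<in>K. V \<subseteq> topspace X // r \<and> openin X {x \<in> topspace X. r `` {x} \<in> V}"
    then show "\<Union>K \<subseteq> topspace X // r" by blast
    have "{x \<in> topspace X. r `` {x} \<in> \<Union>K} = (\<Union>V\<in>K. {x \<in> topspace X. r `` {x} \<in> V})"
      by auto
    also have "openin X \<dots>" using K by (intro openin_clauses(3)) auto
    finally show "openin X {x \<in> topspace X. r `` {x} \<in> \<Union>K}" .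
  qed
  then show ?thesis
    by (simp add: quotient_topology_def)
qed

lemma topspace_quotient_topology: "topspace (quotient_topology X r) = topspace X // r"
proof -
  have "{x \<in> topspace X. r `` {x} \<in> topspace X // r} = topspace X"
    by (auto intro: quotientI)
  then have "openin (quotient_topology X r) (topspace X // r)"
    by (simp add: openin_quotient_topology)
  then show ?thesis
    by (meson openin_quotient_topology openin_subset openin_topspace subset_antisym)
qed

lemma quotient_map_quotient_topology:
  "quotient_map X (quotient_topology X r) (\<lambda>x. r `` {x})"
  by (auto simp: quotient_map_def openin_quotient_topology topspace_quotient_topology
      quotient_def)

text \<open>
  Here \<open>exponential_space B\<close> is the underlying space of \<open>E(Y,B)\<close>, with the quotient topology;
  \<open>monoidal_base_exponential\<close> confirms that \<open>exponential_base B\<close> is a monoidal base of it.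
\<close>

definition exponential_space :: "'y set set \<Rightarrow> 'y set set topology" where
  "exponential_space B =
     quotient_topology (powerset_topology B) (same_opens (powerset_topology B))"

definition exponential_base :: "'y set set \<Rightarrow> 'y set set set set" where
  "exponential_base B = (\<lambda>U. (\<lambda>A. same_opens (powerset_topology B) `` {A}) ` Pow U) ` B"

lemma monoidal_base_exponential:
  assumes "monoidal_base Y B"
  shows "monoidal_base (exponential_space B) (exponential_base B)"
proof -
  define P where "P = powerset_topology B"
  define c where "c = (\<lambda>A. same_opens P `` {A})"
  have opP: "openin P = arbitrary union_of (\<lambda>W. W \<in> Pow ` B)"
    and tsP: "topspace P = Pow (topspace Y)"
    using openin_powerset_topology[OF assms] topspace_powerset_topology[OF assms]
    by (simp_all add: P_def)
  have Pow_open: "openin P (Pow U)" if "U \<in> B" for U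
    using that by (auto simp: opP intro!: arbitrary_union_of_inc)
  have B: "topspace Y \<in> B" "\<And>U V. U \<in> B \<Longrightarrow> V \<in> B \<Longrightarrow> U \<inter> V \<in> B"
    using assms by (auto simp: monoidal_base_def)
  have BY: "U \<subseteq> topspace Y" if "U \<in> B" for U
    using openin_subset[OF Pow_open[OF that]] tsP by auto
  have c_iff: "c A = c A' \<longleftrightarrow> (A, A') \<in> same_opens P"
    if "A \<subseteq> topspace Y" "A' \<subseteq> topspace Y" for A A'
    using that eq_equiv_class_iff[OF equiv_same_opens[of P]] by (simp add: c_def tsP)
  have mem: "c A \<in> c ` Pow U \<longleftrightarrow> A \<subseteq> U" if "U \<in> B" "A \<subseteq> topspace Y" for A U
  proof
    assume "c A \<in> c ` Pow U"
    then obtain A' where A': "A' \<subseteq> U" "c A = c A'" by auto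
    then have "(A, A') \<in> same_opens P"
      using c_iff[of A A'] that BY[OF that(1)] by auto
    with Pow_open[OF that(1)] A' show "A \<subseteq> U" by (auto simp: same_opens_def)
  qed auto
  have E: "exponential_base B = (\<lambda>U. c ` Pow U) ` B"
    by (simp add: exponential_base_def c_def P_def)
  have S: "exponential_space B = quotient_topology P (same_opens P)"
    by (simp add: exponential_space_def P_def)
  have tsE: "topspace (exponential_space B) = c ` Pow (topspace Y)"
    by (auto simp: S topspace_quotient_topology tsP quotient_def c_def)
  have opE: "openin (exponential_space B) V \<longleftrightarrow>
      V \<subseteq> c ` Pow (topspace Y) \<and> openin P {A. A \<subseteq> topspace Y \<and> c A \<in> V}" for V
    using tsE unfolding S topspace_quotient_topology
    by (simp add: openin_quotient_topology tsP c_def)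
  have "openin (exponential_space B) = arbitrary union_of (\<lambda>U. U \<in> exponential_base B)"
    unfolding openin_topology_base_unique
  proof (intro conjI allI impI)
    fix V assume "V \<in> exponential_base B"
    then obtain U where U: "U \<in> B" "V = c ` Pow U" by (auto simp: E)
    have "{A. A \<subseteq> topspace Y \<and> c A \<in> V} = Pow U"
      using mem[OF U(1)] BY[OF U(1)] U(2) by auto
    then show "openin (exponential_space B) V"
      using Pow_open[OF U(1)] BY[OF U(1)] U(2) by (auto simp: opE)
  next
    fix V x assume V: "openin (exponential_space B) V \<and> x \<in> V"
    then obtain A where A: "A \<subseteq> topspace Y" "x = c A" by (auto simp: opE)
    have "(arbitrary union_of (\<lambda>W. W \<in> Pow ` B)) {A. A \<subseteq> topspace Y \<and> c A \<in> V}"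
      using V by (simp add: opE flip: opP)
    then obtain \<U> where \<U>: "\<U> \<subseteq> Pow ` B" "\<Union>\<U> = {A. A \<subseteq> topspace Y \<and> c A \<in> V}"
      by (auto simp: union_of_def arbitrary_def)
    have "A \<in> \<Union>\<U>"
      unfolding \<U>(2) using A V by simp
    then obtain W where W: "A \<in> W" "W \<in> \<U>" by (rule UnionE)
    then obtain U where U: "U \<in> B" "W = Pow U" using \<U>(1) by auto
    have AU: "A \<in> Pow U" using W(1) U(2) by simp
    have UV: "Pow U \<subseteq> {A. A \<subseteq> topspace Y \<and> c A \<in> V}"
      unfolding \<U>(2)[symmetric] U(2)[symmetric] using W(2) by (rule Union_upper)
    have "c ` Pow U \<in> exponential_base B"
      unfolding E using U(1) by (rule imageI)
    moreover have "x \<in> c ` Pow U"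
      unfolding A(2) using AU by (rule imageI)
    moreover have "c ` Pow U \<subseteq> V"
    proof (rule image_subsetI)
      fix A' assume "A' \<in> Pow U"
      from subsetD[OF UV this] show "c A' \<in> V" by simp
    qed
    ultimately show "\<exists>W. W \<in> exponential_base B \<and> x \<in> W \<and> W \<subseteq> V" by blast
  qed
  moreover have "topspace (exponential_space B) \<in> exponential_base B"
    using B(1) by (auto simp: tsE E)
  moreover have "c ` Pow U \<inter> c ` Pow V = c ` Pow (U \<inter> V)" if "U \<in> B" "V \<in> B" for U V
  proof
    show "c ` Pow U \<inter> c ` Pow V \<subseteq> c ` Pow (U \<inter> V)"
    proof
      fix x assume x: "x \<in> c ` Pow U \<inter> c ` Pow V"
      then obtain A where A: "A \<subseteq> U" "x = c A" by auto
      with mem[OF that(2), of A] x BY[OF that(1)] have "A \<subseteq> V" by auto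
      with A show "x \<in> c ` Pow (U \<inter> V)" by auto
    qed
  qed auto
  then have "\<forall>U\<in>exponential_base B. \<forall>V\<in>exponential_base B. U \<inter> V \<in> exponential_base B"
    using B(2) by (auto simp: E simp del: Pow_Int_eq)
  ultimately show ?thesis by (simp add: monoidal_base_def)
qed

end

theory Submission
  imports Defs
begin

text \<open>
  All three conditions say that \<open>X\<close> is a finite lattice whose open sets are the down-sets. Such
  spaces are captured by the locale \<open>finite_lattice_space\<close>, in which \<open>D x\<close> is the principal down-set
  of \<open>x\<close>; an order isomorphism between two of them is a homeomorphism (\<open>order_iso_homeomorphic\<close>).

  Let \<open>M\<close> be generated by a finite set \<open>A\<close>. A prime ideal is determined by the generators it
  contains, so there are finitely many. A basic open set consists of the primes avoiding some \<open>f\<close>;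
  since a union of primes is prime, these are the primes below a largest one. Conversely the primes
  below \<open>p\<close> are those avoiding the product of the generators outside \<open>p\<close>. Hence \<open>kato_spec M\<close> is the
  lattice of primes with its down-set topology (\<open>finite_lattice_space_kato_spec\<close>). In \<open>E(Y,B)\<close> with
  \<open>Y\<close> finite, every class \<open>[A]\<close> has a largest member, the intersection of all \<open>U \<in> B\<close> with
  \<open>A \<subseteq> U\<close>, so \<open>E(Y,B)\<close> is the lattice \<open>(B, \<subseteq>)\<close> with its down-set topology
  (\<open>finite_lattice_space_exponential\<close>).

  Given a finite lattice \<open>L\<close>, the finite monoid \<open>(L, \<sqinter>, \<top>)\<close> has as complements of its primes exactly
  the filters of \<open>L\<close>; these are principal, so the spectrum is \<open>L\<close> again
  (\<open>homeomorphic_kato_spec_meet_monoid\<close>). The principal down-sets of \<open>L\<close> form a monoidal base of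
  \<open>L\<close> that is order isomorphic to \<open>L\<close>, so \<open>L\<close>, a \<open>T\<^sub>0\<close> space, is homeomorphic to its own
  exponential for this base (\<open>homeomorphic_exponential_space\<close>). As \<open>L\<close> is finite, it can be moved
  to any infinite type beforehand (\<open>transfer_to_infinite_type\<close>).
\<close>

section \<open>Finite lattices with the down-set topology\<close>

lemma down_set_subset_iff:
  assumes "Q c"
  shows "{d. Q d \<and> g d \<subseteq> g c} \<subseteq> {d. Q d \<and> g d \<subseteq> g c'} \<longleftrightarrow> g c \<subseteq> g c'"
  using assms by (auto simp only: Collect_mono_iff intro: order_trans)

text \<open>
  The order is \<open>D x \<subseteq> D y\<close>. A monoidal base of principal down-sets provides a top element and
  binary meets, which suffices for a finite poset to be a lattice: joins are meets of the finitely
  many upper bounds.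
\<close>

locale finite_lattice_space =
  fixes X :: "'a topology" and D :: "'a \<Rightarrow> 'a set"
  assumes finite_space: "finite (topspace X)"
    and inj_D: "inj_on D (topspace X)"
    and base: "monoidal_base X (D ` topspace X)"
    and mem_D_iff: "\<lbrakk>x \<in> topspace X; y \<in> topspace X\<rbrakk> \<Longrightarrow> y \<in> D x \<longleftrightarrow> D y \<subseteq> D x"
begin

lemma openin_D: "x \<in> topspace X \<Longrightarrow> openin X (D x)"
  using base by (auto simp: monoidal_base_def intro!: arbitrary_union_of_inc)

lemma D_subset: "x \<in> topspace X \<Longrightarrow> D x \<subseteq> topspace X"
  using openin_D openin_subset by blast

lemma D_eq: "x \<in> topspace X \<Longrightarrow> D x = {y \<in> topspace X. D y \<subseteq> D x}"
  using mem_D_iff D_subset by blast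

lemma openin_iff_down_set: "openin X U \<longleftrightarrow> U \<subseteq> topspace X \<and> (\<forall>x\<in>U. D x \<subseteq> U)"
proof
  assume U: "openin X U"
  then have sub: "U \<subseteq> topspace X" by (rule openin_subset)
  moreover have "D x \<subseteq> U" if "x \<in> U" for x
  proof -
    have "(arbitrary union_of (\<lambda>V. V \<in> D ` topspace X)) U"
      using base U by (simp add: monoidal_base_def)
    then obtain \<U> where "\<U> \<subseteq> D ` topspace X" "\<Union>\<U> = U"
      by (auto simp: union_of_def arbitrary_def)
    with that obtain y where y: "y \<in> topspace X" "x \<in> D y" "D y \<subseteq> U" by blast
    have "D x \<subseteq> D y" using mem_D_iff[of y x] y sub that by auto
    with y(3) show ?thesis by simp
  qed
  ultimately show "U \<subseteq> topspace X \<and> (\<forall>x\<in>U. D x \<subseteq> U)" by blast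
next
  assume U: "U \<subseteq> topspace X \<and> (\<forall>x\<in>U. D x \<subseteq> U)"
  then have "x \<in> D x" if "x \<in> U" for x using mem_D_iff[of x x] that by auto
  with U have "U = (\<Union>x\<in>U. D x)" by blast
  moreover have "openin X (\<Union>x\<in>U. D x)" using U openin_D by blast
  ultimately show "openin X U" by simp
qed

lemma t0_space: "t0_space X"
  unfolding t0_space_def
proof (intro ballI impI)
  fix x y assume xy: "x \<in> topspace X" "y \<in> topspace X" "x \<noteq> y"
  then have "D x \<noteq> D y" using inj_D by (auto dest: inj_onD)
  then have "x \<notin> D y \<or> y \<notin> D x"
    using xy mem_D_iff[of x y] mem_D_iff[of y x] by auto
  moreover have "x \<in> D x" "y \<in> D y" using xy mem_D_iff by auto
  ultimately show "\<exists>U. openin X U \<and> (x \<notin> U \<longleftrightarrow> y \<in> U)" using xy openin_D by blast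
qed

end

lemma order_iso_homeomorphic:
  assumes "finite_lattice_space X D" "finite_lattice_space Y E"
    and bij: "bij_betw f (topspace X) (topspace Y)"
    and iso: "\<And>x y. \<lbrakk>x \<in> topspace X; y \<in> topspace X\<rbrakk> \<Longrightarrow> E (f x) \<subseteq> E (f y) \<longleftrightarrow> D x \<subseteq> D y"
  shows "X homeomorphic_space Y"
proof -
  interpret X: finite_lattice_space X D by fact
  interpret Y: finite_lattice_space Y E by fact
  have img: "f ` topspace X = topspace Y" and inj: "inj_on f (topspace X)"
    using bij by (auto simp: bij_betw_def)
  have fD: "E (f x) = f ` D x" if x: "x \<in> topspace X" for x
  proof -
    have "E (f x) = {z \<in> topspace Y. E z \<subseteq> E (f x)}"
      using x img by (intro Y.D_eq) auto
    also have "\<dots> = f ` {y \<in> topspace X. E (f y) \<subseteq> E (f x)}"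
      by (auto simp flip: img)
    also have "{y \<in> topspace X. E (f y) \<subseteq> E (f x)} = {y \<in> topspace X. D y \<subseteq> D x}"
      using iso[OF _ x] by (intro Collect_cong conj_cong) auto
    also have "\<dots> = D x" using X.D_eq[OF x] by (rule sym)
    finally show ?thesis .
  qed
  have "openin X {x \<in> topspace X. f x \<in> U} \<longleftrightarrow> openin Y U" if "U \<subseteq> topspace Y" for U
  proof -
    let ?V = "{x \<in> topspace X. f x \<in> U}"
    have "D x \<subseteq> ?V \<longleftrightarrow> E (f x) \<subseteq> U" if "x \<in> ?V" for x
      using that X.D_subset[of x] by (auto simp: fD)
    moreover have "U = f ` ?V"
      using that by (auto simp flip: img)
    ultimately have "(\<forall>x\<in>?V. D x \<subseteq> ?V) \<longleftrightarrow> (\<forall>y\<in>U. E y \<subseteq> U)"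
      by (metis (no_types, lifting) image_iff)
    with that show ?thesis
      unfolding X.openin_iff_down_set Y.openin_iff_down_set by simp
  qed
  then have "quotient_map X Y f" using img by (simp add: quotient_map_def)
  with inj have "homeomorphic_map X Y f" by (simp add: homeomorphic_map_def)
  then show ?thesis by (rule homeomorphic_map_imp_homeomorphic_space)
qed

lemma (in finite_lattice_space) transfer_to_infinite_type:
  "\<exists>(Y :: 'y::infinite topology) E. finite_lattice_space Y E \<and> X homeomorphic_space Y"
proof -
  let ?S = "topspace X"
  obtain T :: "'y set" where "finite T" "card T = card ?S"
    using infinite_arbitrarily_large[OF infinite_UNIV] by metis
  then obtain h where h: "bij_betw h ?S T"
    using finite_same_card_bij finite_space by metis
  then have inj: "inj_on h ?S" and img: "h ` ?S = T" by (auto simp: bij_betw_def)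
  define E where "E y = h ` D (inv_into ?S h y)" for y
  have E: "E (h x) = h ` D x" if "x \<in> ?S" for x
    using that inj by (simp add: E_def)
  have E_le: "E (h x) \<subseteq> E (h y) \<longleftrightarrow> D x \<subseteq> D y" if "x \<in> ?S" "y \<in> ?S" for x y
    using that inj E D_subset inj_on_image_subset_iff[of h ?S] by metis
  have Eimg: "E ` T = (`) h ` D ` ?S"
    using E by (auto simp: img[symmetric] image_iff)
  have Int: "U \<inter> V \<in> E ` T" if "U \<in> E ` T" "V \<in> E ` T" for U V
  proof -
    obtain x y where xy: "x \<in> ?S" "y \<in> ?S" "U = h ` D x" "V = h ` D y"
      using \<open>U \<in> E ` T\<close> \<open>V \<in> E ` T\<close> unfolding Eimg by auto
    then have "U \<inter> V = h ` (D x \<inter> D y)"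
      using inj_on_image_Int[OF inj] D_subset by simp
    moreover have "D x \<inter> D y \<in> D ` ?S"
      using base xy by (auto simp: monoidal_base_def)
    ultimately show ?thesis by (auto simp: Eimg)
  qed
  define Y where "Y = topology (arbitrary union_of (\<lambda>U. U \<in> E ` T))"
  have "istopology (arbitrary union_of (\<lambda>U. U \<in> E ` T))"
    by (rule istopology_base) (rule Int)
  then have opY: "openin Y = arbitrary union_of (\<lambda>U. U \<in> E ` T)"
    by (simp add: Y_def)
  have T: "T \<in> E ` T"
    using base img by (auto simp: Eimg monoidal_base_def)
  have ET: "U \<subseteq> T" if "U \<in> E ` T" for U
  proof -
    from that obtain x where "x \<in> ?S" "U = h ` D x" by (auto simp: Eimg)
    then show ?thesis using D_subset image_mono[of "D x" ?S h] img by simp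
  qed
  have tsY: "topspace Y = T"
  proof
    have "(arbitrary union_of (\<lambda>U. U \<in> E ` T)) (topspace Y)"
      by (simp flip: opY)
    then obtain \<U> where \<U>: "\<U> \<subseteq> E ` T" "topspace Y = \<Union>\<U>"
      by (auto simp: union_of_def arbitrary_def)
    show "topspace Y \<subseteq> T"
      unfolding \<U>(2) by (rule Union_least, rule ET) (rule subsetD[OF \<U>(1)])
    have "openin Y T" using T by (simp add: opY arbitrary_union_of_inc)
    then show "T \<subseteq> topspace Y" by (rule openin_subset)
  qed
  have "finite_lattice_space Y E"
  proof
    show "finite (topspace Y)" by (simp add: tsY \<open>finite T\<close>)
    show "inj_on E (topspace Y)"
    proof (rule inj_onI)
      fix a b assume "a \<in> topspace Y" "b \<in> topspace Y" and eq: "E a = E b"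
      then obtain x y where xy: "x \<in> ?S" "y \<in> ?S" "a = h x" "b = h y"
        using img tsY by auto
      then have "D x = D y" using eq E_le[of x y] E_le[of y x] by auto
      with xy show "a = b" using inj_D by (auto dest: inj_onD)
    qed
    show "monoidal_base Y (E ` topspace Y)"
      using T Int by (simp add: monoidal_base_def opY tsY)
    fix a b assume "a \<in> topspace Y" "b \<in> topspace Y"
    then obtain x y where xy: "x \<in> ?S" "y \<in> ?S" "a = h x" "b = h y"
      using img tsY by auto
    then have "h y \<in> h ` D x \<longleftrightarrow> y \<in> D x"
      using inj_on_image_mem_iff[OF inj] D_subset by blast
    then show "b \<in> E a \<longleftrightarrow> E b \<subseteq> E a"
      using xy E_le mem_D_iff E by simp
  qed
  moreover have "X homeomorphic_space Y"
    using order_iso_homeomorphic[OF finite_lattice_space_axioms calculation, of h] h E_le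
    by (simp add: tsY)
  ultimately show ?thesis by blast
qed

section \<open>Spectra of finitely generated monoids are finite lattices\<close>

lemma monoid_prime_ideal_one:
  "monoid_prime_ideal M p \<Longrightarrow> \<one>\<^bsub>M\<^esub> \<notin> p"
  using submonoid.one_closed[of "carrier M - p" M] by (simp add: monoid_prime_ideal_def)

lemma monoid_prime_ideal_carrier:
  "monoid_prime_ideal M p \<Longrightarrow> p \<subseteq> carrier M"
  by (simp add: monoid_prime_ideal_def monoid_ideal_def)

lemma monoid_prime_idealI:
  assumes "comm_monoid M" "p \<subseteq> carrier M" "\<one>\<^bsub>M\<^esub> \<notin> p"
    and "\<And>x y. \<lbrakk>x \<in> carrier M; y \<in> carrier M\<rbrakk> \<Longrightarrow> x \<otimes>\<^bsub>M\<^esub> y \<in> p \<longleftrightarrow> x \<in> p \<or> y \<in> p"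
  shows "monoid_prime_ideal M p"
proof -
  interpret comm_monoid M by fact
  show ?thesis
    using assms(2-4)
    by (auto simp: monoid_prime_ideal_def monoid_ideal_def intro!: submonoid.intro)
qed

lemma monoid_prime_ideal_Union:
  assumes "comm_monoid M" "\<And>p. p \<in> \<P> \<Longrightarrow> monoid_prime_ideal M p"
  shows "monoid_prime_ideal M (\<Union>\<P>)"
proof (rule monoid_prime_idealI[OF assms(1)])
  show "\<Union>\<P> \<subseteq> carrier M" using assms(2) monoid_prime_ideal_carrier by blast
  show "\<one>\<^bsub>M\<^esub> \<notin> \<Union>\<P>" using assms(2) monoid_prime_ideal_one by blast
  show "x \<otimes>\<^bsub>M\<^esub> y \<in> \<Union>\<P> \<longleftrightarrow> x \<in> \<Union>\<P> \<or> y \<in> \<Union>\<P>"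
    if "x \<in> carrier M" "y \<in> carrier M" for x y
    using monoid_prime_ideal_mult_iff[OF assms(1) assms(2) that] by blast
qed

text \<open>
  The elements \<open>x\<close> with \<open>x \<in> p \<longrightarrow> x \<in> q\<close> form a submonoid, because \<open>p\<close> is prime and \<open>q\<close> an ideal.
\<close>

lemma monoid_prime_ideal_subset_iff_generators:
  assumes "comm_monoid M" "(\<lambda>H. submonoid H M) hull A = carrier M"
    and p: "monoid_prime_ideal M p" and q: "monoid_prime_ideal M q"
  shows "p \<subseteq> q \<longleftrightarrow> p \<inter> A \<subseteq> q"
proof
  interpret comm_monoid M by fact
  assume pq: "p \<inter> A \<subseteq> q"
  let ?H = "{x \<in> carrier M. x \<in> p \<longrightarrow> x \<in> q}"
  have "A \<subseteq> carrier M" using hull_subset[of A "\<lambda>H. submonoid H M"] assms(2) by simp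
  with pq have "A \<subseteq> ?H" by blast
  moreover have "submonoid ?H M"
  proof
    show "\<one>\<^bsub>M\<^esub> \<in> ?H" using monoid_prime_ideal_one[OF p] by simp
    show "x \<otimes>\<^bsub>M\<^esub> y \<in> ?H" if "x \<in> ?H" "y \<in> ?H" for x y
      using that monoid_prime_ideal_mult_iff[OF assms(1) p]
        monoid_prime_ideal_mult_iff[OF assms(1) q] by auto
  qed auto
  ultimately have "carrier M \<subseteq> ?H"
    using hull_minimal[of A ?H "\<lambda>H. submonoid H M"] assms(2) by simp
  then show "p \<subseteq> q" using monoid_prime_ideal_carrier[OF p] by blast
qed blast

text \<open>
  The product of the elements of \<open>S\<close> lies in a prime ideal exactly if one of the factors does.
\<close>

lemma ex_product_mem_prime_iff:
  assumes "comm_monoid M" "finite S" "S \<subseteq> carrier M"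
  shows "\<exists>f\<in>carrier M. \<forall>q. monoid_prime_ideal M q \<longrightarrow> (f \<in> q \<longleftrightarrow> q \<inter> S \<noteq> {})"
  using assms(2,3)
proof (induction S rule: finite_induct)
  case empty
  interpret comm_monoid M by fact
  show ?case using monoid_prime_ideal_one by auto
next
  case (insert a S)
  interpret comm_monoid M by fact
  obtain f where f: "f \<in> carrier M" "\<And>q. monoid_prime_ideal M q \<Longrightarrow> f \<in> q \<longleftrightarrow> q \<inter> S \<noteq> {}"
    using insert by auto
  have "a \<otimes>\<^bsub>M\<^esub> f \<in> q \<longleftrightarrow> q \<inter> insert a S \<noteq> {}" if "monoid_prime_ideal M q" for q
    using monoid_prime_ideal_mult_iff[OF assms(1) that, of a f] insert.prems f that by auto
  then show ?case using insert.prems f(1) by (intro bexI[of _ "a \<otimes>\<^bsub>M\<^esub> f"]) auto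
qed

lemma finite_lattice_space_kato_spec:
  assumes M: "comm_monoid M" and "finitely_generated_monoid M"
  shows "finite_lattice_space (kato_spec M) (\<lambda>p. {q. monoid_prime_ideal M q \<and> q \<subseteq> p})"
    (is "finite_lattice_space _ ?D")
proof -
  interpret comm_monoid M by fact
  obtain A where A: "finite A" "A \<subseteq> carrier M" "(\<lambda>H. submonoid H M) hull A = carrier M"
    using assms(2) by (auto simp: finitely_generated_monoid_def)
  let ?S = "{p. monoid_prime_ideal M p}"
  note ts = topspace_kato_spec[OF M]
  note sub_iff = monoid_prime_ideal_subset_iff_generators[OF M A(3)]
  have eq: "?D ` ?S = spec_basic_open M ` carrier M"
  proof (intro equalityI image_subsetI)
    fix p assume "p \<in> ?S"
    then have p: "monoid_prime_ideal M p" by simp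
    \<comment> \<open>The product of the generators outside \<open>p\<close> is avoided exactly by the primes below \<open>p\<close>.\<close>
    obtain f where f: "f \<in> carrier M"
        "\<And>q. monoid_prime_ideal M q \<Longrightarrow> f \<in> q \<longleftrightarrow> q \<inter> (A - p) \<noteq> {}"
      using ex_product_mem_prime_iff[OF M, of "A - p"] A(1,2) by auto
    have "q \<subseteq> p \<longleftrightarrow> f \<notin> q" if q: "monoid_prime_ideal M q" for q
      unfolding sub_iff[OF q p] f(2)[OF q] by blast
    then have "?D p = spec_basic_open M f"
      unfolding spec_basic_open_def by (intro Collect_cong conj_cong refl)
    with f(1) show "?D p \<in> spec_basic_open M ` carrier M" by blast
  next
    fix f
    \<comment> \<open>A union of primes is prime, so there is a largest prime avoiding \<open>f\<close>.\<close>
    let ?p = "\<Union>(spec_basic_open M f)"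
    have "monoid_prime_ideal M ?p"
      by (rule monoid_prime_ideal_Union[OF M]) (simp add: spec_basic_open_def)
    moreover have "spec_basic_open M f = ?D ?p"
      by (auto simp: spec_basic_open_def)
    ultimately show "spec_basic_open M f \<in> ?D ` ?S" by blast
  qed
  show ?thesis
  proof
    have "inj_on (\<lambda>p. p \<inter> A) ?S"
    proof (rule inj_onI)
      fix p q assume "p \<in> ?S" "q \<in> ?S" "p \<inter> A = q \<inter> A"
      then show "p = q" using sub_iff[of p q] sub_iff[of q p] by auto
    qed
    moreover have "finite ((\<lambda>p. p \<inter> A) ` ?S)"
      by (rule finite_subset[of _ "Pow A"]) (auto simp: A(1))
    ultimately show "finite (topspace (kato_spec M))"
      using finite_imageD ts by metis
    show "inj_on ?D (topspace (kato_spec M))"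
      unfolding ts by (rule inj_onI) blast
    have "?S \<in> spec_basic_open M ` carrier M"
      using spec_basic_open_one[of M] by blast
    then show "monoidal_base (kato_spec M) (?D ` topspace (kato_spec M))"
      unfolding ts eq monoidal_base_def openin_kato_spec[OF M]
      by (auto simp: spec_basic_open_Int[OF M])
  qed (auto simp: ts)
qed

lemma finite_imp_finitely_generated_monoid:
  assumes "monoid M" "finite (carrier M)"
  shows "finitely_generated_monoid M"
proof -
  interpret monoid M by fact
  have "submonoid (carrier M) M" by (rule submonoid.intro) auto
  then have "(\<lambda>H. submonoid H M) hull carrier M = carrier M" by (rule hull_same)
  with assms(2) show ?thesis by (auto simp: finitely_generated_monoid_def)
qed

section \<open>Every finite lattice is the spectrum of its meet monoid\<close>

context finite_lattice_space
begin

definition meet_monoid :: "'a monoid" where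
  "meet_monoid = \<lparr>carrier = topspace X,
     monoid.mult = (\<lambda>x y. inv_into (topspace X) D (D x \<inter> D y)),
     one = inv_into (topspace X) D (topspace X)\<rparr>"

lemma carrier_meet_monoid [simp]: "carrier meet_monoid = topspace X"
  by (simp add: meet_monoid_def)

lemma meet_in_space:
  assumes "x \<in> topspace X" "y \<in> topspace X"
  shows "x \<otimes>\<^bsub>meet_monoid\<^esub> y \<in> topspace X" and "D (x \<otimes>\<^bsub>meet_monoid\<^esub> y) = D x \<inter> D y"
proof -
  have "D x \<inter> D y \<in> D ` topspace X"
    using base assms by (auto simp: monoidal_base_def)
  then show "x \<otimes>\<^bsub>meet_monoid\<^esub> y \<in> topspace X" and "D (x \<otimes>\<^bsub>meet_monoid\<^esub> y) = D x \<inter> D y"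
    by (simp_all add: meet_monoid_def inv_into_into f_inv_into_f)
qed

lemma top_in_space:
  shows "\<one>\<^bsub>meet_monoid\<^esub> \<in> topspace X" and "D \<one>\<^bsub>meet_monoid\<^esub> = topspace X"
proof -
  have "topspace X \<in> D ` topspace X"
    using base by (auto simp: monoidal_base_def)
  then show "\<one>\<^bsub>meet_monoid\<^esub> \<in> topspace X" and "D \<one>\<^bsub>meet_monoid\<^esub> = topspace X"
    by (simp_all add: meet_monoid_def inv_into_into f_inv_into_f)
qed

lemma D_eqD: "\<lbrakk>D x = D y; x \<in> topspace X; y \<in> topspace X\<rbrakk> \<Longrightarrow> x = y"
  using inj_D by (auto dest: inj_onD)

lemma comm_monoid_meet_monoid: "comm_monoid meet_monoid"
proof
  fix x y z
  assume "x \<in> carrier meet_monoid" "y \<in> carrier meet_monoid" "z \<in> carrier meet_monoid"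
  then show "x \<otimes>\<^bsub>meet_monoid\<^esub> y \<otimes>\<^bsub>meet_monoid\<^esub> z = x \<otimes>\<^bsub>meet_monoid\<^esub> (y \<otimes>\<^bsub>meet_monoid\<^esub> z)"
    by (intro D_eqD) (auto simp: meet_in_space)
next
  fix x assume x: "x \<in> carrier meet_monoid"
  then show "\<one>\<^bsub>meet_monoid\<^esub> \<otimes>\<^bsub>meet_monoid\<^esub> x = x"
    using D_subset[of x] by (intro D_eqD) (auto simp: meet_in_space top_in_space)
  show "x \<otimes>\<^bsub>meet_monoid\<^esub> \<one>\<^bsub>meet_monoid\<^esub> = x"
    using x D_subset[of x] by (intro D_eqD) (auto simp: meet_in_space top_in_space)
next
  fix x y assume "x \<in> carrier meet_monoid" "y \<in> carrier meet_monoid"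
  then show "x \<otimes>\<^bsub>meet_monoid\<^esub> y = y \<otimes>\<^bsub>meet_monoid\<^esub> x"
    by (intro D_eqD) (auto simp: meet_in_space)
qed (auto simp: meet_in_space top_in_space)

text \<open>
  The complement of a prime is a filter: it is closed under meets by primality and upwards by the
  ideal property. In a finite lattice it is therefore generated by its least element.
\<close>

lemma prime_ideals_meet_monoid:
  "monoid_prime_ideal meet_monoid p \<longleftrightarrow>
     (\<exists>x\<in>topspace X. p = {y \<in> topspace X. \<not> D x \<subseteq> D y})"
proof
  assume p: "monoid_prime_ideal meet_monoid p"
  let ?F = "topspace X - p"
  note mult_iff = monoid_prime_ideal_mult_iff[OF comm_monoid_meet_monoid p, simplified]
  have "\<one>\<^bsub>meet_monoid\<^esub> \<in> ?F"
    using monoid_prime_ideal_one[OF p] top_in_space by simp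
  then have "D ` ?F \<noteq> {}" by blast
  moreover have "finite (D ` ?F)" using finite_space by simp
  ultimately have "\<exists>m\<in>D ` ?F. \<forall>b\<in>D ` ?F. b \<subseteq> m \<longrightarrow> m = b"
    by (rule finite_has_minimal[rotated])
  then obtain x where x: "x \<in> ?F" and min: "\<And>y. y \<in> ?F \<Longrightarrow> D y \<subseteq> D x \<Longrightarrow> D x = D y"
    by (auto simp del: Diff_iff)
  have "y \<in> ?F \<longleftrightarrow> D x \<subseteq> D y" if y: "y \<in> topspace X" for y
  proof
    assume "y \<in> ?F"
    then have "x \<otimes>\<^bsub>meet_monoid\<^esub> y \<in> ?F"
      using x mult_iff meet_in_space by simp
    then have "D x = D (x \<otimes>\<^bsub>meet_monoid\<^esub> y)"
      using x y by (intro min) (auto simp: meet_in_space)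
    then show "D x \<subseteq> D y" using x y meet_in_space[of x y] by auto
  next
    assume "D x \<subseteq> D y"
    then have "x \<otimes>\<^bsub>meet_monoid\<^esub> y = x"
      using x y meet_in_space by (intro D_eqD) auto
    then show "y \<in> ?F" using mult_iff[of x y] x y by auto
  qed
  then have "p = {y \<in> topspace X. \<not> D x \<subseteq> D y}"
    using monoid_prime_ideal_carrier[OF p] by auto
  with x show "\<exists>x\<in>topspace X. p = {y \<in> topspace X. \<not> D x \<subseteq> D y}" by blast
next
  assume "\<exists>x\<in>topspace X. p = {y \<in> topspace X. \<not> D x \<subseteq> D y}"
  then show "monoid_prime_ideal meet_monoid p"
    by (auto intro!: monoid_prime_idealI[OF comm_monoid_meet_monoid]
        dest: D_subset[THEN subsetD] simp: meet_in_space top_in_space)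
qed

lemma homeomorphic_kato_spec_meet_monoid: "X homeomorphic_space kato_spec meet_monoid"
proof -
  let ?P = "\<lambda>x. {y \<in> topspace X. \<not> D x \<subseteq> D y}"
  have le: "?P x \<subseteq> ?P y \<longleftrightarrow> D x \<subseteq> D y" if "x \<in> topspace X" "y \<in> topspace X" for x y
    using that by blast
  have ts: "topspace (kato_spec meet_monoid) = ?P ` topspace X"
    unfolding topspace_kato_spec[OF comm_monoid_meet_monoid] prime_ideals_meet_monoid by blast
  have spec: "finite_lattice_space (kato_spec meet_monoid)
      (\<lambda>p. {q. monoid_prime_ideal meet_monoid q \<and> q \<subseteq> p})"
    using finite_space comm_monoid_meet_monoid
    by (intro finite_lattice_space_kato_spec finite_imp_finitely_generated_monoid)
      (auto simp: comm_monoid_def)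
  show ?thesis
  proof (rule order_iso_homeomorphic[OF finite_lattice_space_axioms spec])
    have "inj_on ?P (topspace X)"
    proof (rule inj_onI)
      fix x y assume "x \<in> topspace X" "y \<in> topspace X" "?P x = ?P y"
      with le[of x y] le[of y x] show "x = y" by (intro D_eqD) auto
    qed
    then show "bij_betw ?P (topspace X) (topspace (kato_spec meet_monoid))"
      by (simp add: bij_betw_def ts)
    fix x y assume xy: "x \<in> topspace X" "y \<in> topspace X"
    then have prime: "monoid_prime_ideal meet_monoid (?P x)"
      using prime_ideals_meet_monoid by blast
    show "{q. monoid_prime_ideal meet_monoid q \<and> q \<subseteq> ?P x} \<subseteq>
        {q. monoid_prime_ideal meet_monoid q \<and> q \<subseteq> ?P y} \<longleftrightarrow> D x \<subseteq> D y"
      using down_set_subset_iff[where Q = "monoid_prime_ideal meet_monoid"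
          and g = "\<lambda>p. p", OF prime] le[OF xy] by simp
  qed
qed

end

section \<open>Exponentials of finite spaces are finite lattices\<close>

abbreviation exponential_class :: "'y set set \<Rightarrow> 'y set \<Rightarrow> 'y set set" where
  "exponential_class B A \<equiv> same_opens (powerset_topology B) `` {A}"

lemma monoidal_base_subset:
  assumes "monoidal_base Y B" "U \<in> B"
  shows "U \<subseteq> topspace Y"
proof -
  have "openin Y U"
    using assms by (simp add: monoidal_base_def arbitrary_union_of_inc)
  then show ?thesis by (rule openin_subset)
qed

lemma finite_monoidal_base:
  assumes "monoidal_base Y B" "finite (topspace Y)"
  shows "finite B"
proof (rule finite_subset)
  show "B \<subseteq> Pow (topspace Y)" using monoidal_base_subset[OF assms(1)] by auto
qed (use assms(2) in simp)

lemma mem_exponential_class_iff: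
  assumes "monoidal_base Y B" "A \<subseteq> topspace Y"
  shows "A' \<in> exponential_class B A \<longleftrightarrow>
     A' \<subseteq> topspace Y \<and> (\<forall>U\<in>B. A \<subseteq> U \<longleftrightarrow> A' \<subseteq> U)"
proof -
  have "(\<forall>W. openin (powerset_topology B) W \<longrightarrow> (A \<in> W \<longleftrightarrow> A' \<in> W)) \<longleftrightarrow>
      (\<forall>U\<in>B. A \<subseteq> U \<longleftrightarrow> A' \<subseteq> U)" (is "?L \<longleftrightarrow> ?R")
  proof
    assume L: ?L
    show ?R
    proof
      fix U assume "U \<in> B"
      then have "openin (powerset_topology B) (Pow U)"
        by (auto simp: openin_powerset_topology[OF assms(1)] intro!: arbitrary_union_of_inc)
      with L have "A \<in> Pow U \<longleftrightarrow> A' \<in> Pow U" by blast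
      then show "A \<subseteq> U \<longleftrightarrow> A' \<subseteq> U" by simp
    qed
  next
    assume R: ?R
    show ?L
    proof (intro allI impI)
      fix W assume "openin (powerset_topology B) W"
      then obtain \<U> where "\<U> \<subseteq> Pow ` B" "\<Union>\<U> = W"
        by (auto simp: openin_powerset_topology[OF assms(1)] union_of_def arbitrary_def)
      with R show "A \<in> W \<longleftrightarrow> A' \<in> W" by blast
    qed
  qed
  with assms(2) show ?thesis
    by (auto simp: same_opens_def topspace_powerset_topology[OF assms(1)])
qed

lemma Union_exponential_class:
  assumes "monoidal_base Y B" "U \<in> B"
  shows "\<Union>(exponential_class B U) = U"
  using mem_exponential_class_iff[OF assms(1) monoidal_base_subset[OF assms]] assms
    monoidal_base_subset[OF assms] by blast

text \<open>
  The intersection of all members of \<open>B\<close> above \<open>A\<close> is a finite one, hence belongs to \<open>B\<close>, and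
  it is equivalent to \<open>A\<close>. So the members of \<open>B\<close> represent all points of the exponential.
\<close>

lemma topspace_exponential_space:
  assumes B: "monoidal_base Y B" and fin: "finite (topspace Y)"
  shows "topspace (exponential_space B) = exponential_class B ` B"
proof -
  have top: "topspace Y \<in> B" and Int: "\<And>U V. U \<in> B \<Longrightarrow> V \<in> B \<Longrightarrow> U \<inter> V \<in> B"
    using B by (auto simp: monoidal_base_def)
  have "exponential_class B A \<in> exponential_class B ` B" if A: "A \<subseteq> topspace Y" for A
  proof -
    let ?C = "\<Inter>{U \<in> B. A \<subseteq> U}"
    have "?C \<in> B"
    proof -
      have "\<Inter>F \<in> B" if "finite F" "F \<noteq> {}" "F \<subseteq> B" for F
        using that by (induction F rule: finite_ne_induct) (auto intro: Int)
      moreover have "finite {U \<in> B. A \<subseteq> U}" "{U \<in> B. A \<subseteq> U} \<noteq> {}"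
        using finite_monoidal_base[OF assms] top A by auto
      ultimately show ?thesis by blast
    qed
    moreover have "exponential_class B A = exponential_class B ?C"
    proof -
      have "?C \<in> exponential_class B A"
        using monoidal_base_subset[OF B \<open>?C \<in> B\<close>]
        unfolding mem_exponential_class_iff[OF B A] by blast
      then show ?thesis
        using equiv_class_eq[OF equiv_same_opens] by fastforce
    qed
    ultimately show ?thesis by blast
  qed
  moreover have "topspace (exponential_space B) = exponential_class B ` Pow (topspace Y)"
    by (auto simp: exponential_space_def topspace_quotient_topology quotient_def
        topspace_powerset_topology[OF B])
  moreover have "B \<subseteq> Pow (topspace Y)"
    using monoidal_base_subset[OF B] by auto
  ultimately show ?thesis
    using image_mono[of B "Pow (topspace Y)" "exponential_class B"]
    by (intro equalityI) (auto simp only: image_subset_iff Pow_iff)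
qed

text \<open>
  The union of a class is its largest member; by \<open>Union_exponential_class\<close> this identifies the
  points of the exponential with the members of \<open>B\<close>, ordered by inclusion.
\<close>

lemma finite_lattice_space_exponential:
  assumes B: "monoidal_base Y B" and fin: "finite (topspace Y)"
  shows "finite_lattice_space (exponential_space B)
     (\<lambda>c. {d \<in> topspace (exponential_space B). \<Union>d \<subseteq> \<Union>c})"
    (is "finite_lattice_space ?E ?D")
proof -
  note ts = topspace_exponential_space[OF assms]
  note Un = Union_exponential_class[OF B]
  have "?D (exponential_class B U) = exponential_class B ` Pow U" if U: "U \<in> B" for U
  proof
    show "?D (exponential_class B U) \<subseteq> exponential_class B ` Pow U"
      using U Un by (auto simp: ts)
    show "exponential_class B ` Pow U \<subseteq> ?D (exponential_class B U)"
    proof (rule image_subsetI)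
      fix A assume "A \<in> Pow U"
      with monoidal_base_subset[OF B U] have A: "A \<subseteq> U" "A \<subseteq> topspace Y" by auto
      have "exponential_class B A \<in> topspace ?E"
        using A(2) by (auto simp: exponential_space_def topspace_quotient_topology
            topspace_powerset_topology[OF B] intro: quotientI)
      moreover have "\<Union>(exponential_class B A) \<subseteq> U"
        using A U mem_exponential_class_iff[OF B A(2)] by blast
      ultimately show "exponential_class B A \<in> ?D (exponential_class B U)"
        using Un[OF U] by simp
    qed
  qed
  then have base_eq: "?D ` topspace ?E = exponential_base B"
    by (simp add: exponential_base_def ts image_image cong: image_cong)
  show ?thesis
  proof
    show "finite (topspace ?E)" using finite_monoidal_base[OF assms] by (simp add: ts)
    show "inj_on ?D (topspace ?E)"
    proof (rule inj_onI)
      fix c d assume cd: "c \<in> topspace ?E" "d \<in> topspace ?E" "?D c = ?D d"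
      then have "\<Union>c = \<Union>d" by blast
      with cd(1,2) show "c = d" using Un by (auto simp: ts)
    qed
    show "monoidal_base ?E (?D ` topspace ?E)"
      unfolding base_eq by (rule monoidal_base_exponential[OF B])
    show "d \<in> ?D c \<longleftrightarrow> ?D d \<subseteq> ?D c" if "c \<in> topspace ?E" "d \<in> topspace ?E" for c d
      using down_set_subset_iff[of "\<lambda>d. d \<in> topspace ?E" d Union c] that by simp
  qed
qed

lemma (in finite_lattice_space) homeomorphic_exponential_space:
  "X homeomorphic_space exponential_space (D ` topspace X)"
proof -
  let ?B = "D ` topspace X"
  let ?f = "\<lambda>x. exponential_class ?B (D x)"
  note Un = Union_exponential_class[OF base, OF imageI]
  have ts: "topspace (exponential_space ?B) = ?f ` topspace X"
    unfolding topspace_exponential_space[OF base finite_space] by (rule image_image)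
  show ?thesis
  proof (rule order_iso_homeomorphic[OF finite_lattice_space_axioms
        finite_lattice_space_exponential[OF base finite_space], of ?f])
    have "inj_on ?f (topspace X)"
    proof (rule inj_onI)
      fix x y assume xy: "x \<in> topspace X" "y \<in> topspace X" "?f x = ?f y"
      from arg_cong[OF xy(3), of Union] have "D x = D y"
        unfolding Un[OF xy(1)] Un[OF xy(2)] .
      then show "x = y" using xy(1,2) by (rule D_eqD)
    qed
    then show "bij_betw ?f (topspace X) (topspace (exponential_space ?B))"
      unfolding bij_betw_def ts by (intro conjI refl)
    fix x y assume xy: "x \<in> topspace X" "y \<in> topspace X"
    then have point: "?f x \<in> topspace (exponential_space ?B)" unfolding ts by (intro imageI)
    show "{d \<in> topspace (exponential_space ?B). \<Union>d \<subseteq> \<Union>(?f x)} \<subseteq>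
        {d \<in> topspace (exponential_space ?B). \<Union>d \<subseteq> \<Union>(?f y)} \<longleftrightarrow> D x \<subseteq> D y"
      unfolding down_set_subset_iff[where Q = "\<lambda>d. d \<in> topspace (exponential_space ?B)", OF point]
      by (simp only: Un[OF xy(1)] Un[OF xy(2)])
  qed
qed

section \<open>The three descriptions agree\<close>

lemma homeomorphic_finite_lattice_space_imp_kato_spec:
  assumes "X homeomorphic_space Z" "finite_lattice_space Z D"
  shows "\<exists>M :: 'm::infinite monoid.
     comm_monoid M \<and> finite (carrier M) \<and> X homeomorphic_space kato_spec M"
proof -
  obtain Y :: "'m topology" and E where
    Y: "finite_lattice_space Y E" "Z homeomorphic_space Y"
    using finite_lattice_space.transfer_to_infinite_type[OF assms(2)] by blast
  interpret finite_lattice_space Y E by fact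
  show ?thesis
    using comm_monoid_meet_monoid finite_space homeomorphic_kato_spec_meet_monoid
      homeomorphic_space_trans[OF assms(1) homeomorphic_space_trans[OF Y(2)]]
    by (intro exI[of _ meet_monoid]) auto
qed

lemma homeomorphic_finite_lattice_space_imp_exponential_space:
  assumes "X homeomorphic_space Z" "finite_lattice_space Z D"
  shows "\<exists>(Y :: 'y::infinite topology) B. finite (topspace Y) \<and> t0_space Y \<and>
     monoidal_base Y B \<and> X homeomorphic_space exponential_space B"
proof -
  obtain Y :: "'y topology" and E where
    Y: "finite_lattice_space Y E" "Z homeomorphic_space Y"
    using finite_lattice_space.transfer_to_infinite_type[OF assms(2)] by blast
  interpret finite_lattice_space Y E by fact
  show ?thesis
    using finite_space t0_space base homeomorphic_exponential_space
      homeomorphic_space_trans[OF assms(1) homeomorphic_space_trans[OF Y(2)]]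
    by (intro exI[of _ Y] exI[of _ "E ` topspace Y"]) auto
qed

theorem corollary4p3:
  fixes X :: "'a topology"
  shows
    "((\<exists>M :: 'm::infinite monoid.
          comm_monoid M \<and> finite (carrier M) \<and> X homeomorphic_space kato_spec M)
      \<longleftrightarrow>
      (\<exists>M :: 'n::infinite monoid.
          comm_monoid M \<and> finitely_generated_monoid M \<and> X homeomorphic_space kato_spec M))
     \<and>
     ((\<exists>M :: 'n::infinite monoid.
          comm_monoid M \<and> finitely_generated_monoid M \<and> X homeomorphic_space kato_spec M)
      \<longleftrightarrow>
      (\<exists>(Y :: 'y::infinite topology) B.
          finite (topspace Y) \<and> t0_space Y \<and> monoidal_base Y B \<and>
          X homeomorphic_space exponential_space B))"
    (is "(?fin \<longleftrightarrow> ?fg) \<and> (_ \<longleftrightarrow> ?exp)")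
proof -
  have ?fg if ?fin
  proof -
    from that obtain M :: "'m monoid" where M: "comm_monoid M" "finite (carrier M)"
      "X homeomorphic_space kato_spec M" by blast
    then have "finite_lattice_space (kato_spec M) (\<lambda>p. {q. monoid_prime_ideal M q \<and> q \<subseteq> p})"
      by (simp add: finite_lattice_space_kato_spec finite_imp_finitely_generated_monoid
          comm_monoid.axioms(1))
    from homeomorphic_finite_lattice_space_imp_kato_spec[OF M(3) this] show ?thesis
      using finite_imp_finitely_generated_monoid comm_monoid.axioms(1) by blast
  qed
  moreover have ?fin and ?exp if fg: ?fg
  proof -
    obtain M :: "'n monoid" where M: "comm_monoid M" "finitely_generated_monoid M"
      and X: "X homeomorphic_space kato_spec M" using fg by blast
    note lattice = finite_lattice_space_kato_spec[OF M]
    show ?fin by (rule homeomorphic_finite_lattice_space_imp_kato_spec[OF X lattice])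
    show ?exp by (rule homeomorphic_finite_lattice_space_imp_exponential_space[OF X lattice])
  qed
  moreover have ?fg if exp: ?exp
  proof -
    obtain Y :: "'y topology" and B where Y: "monoidal_base Y B" "finite (topspace Y)"
      and X: "X homeomorphic_space exponential_space B" using exp by blast
    from homeomorphic_finite_lattice_space_imp_kato_spec
      [OF X finite_lattice_space_exponential[OF Y]] show ?thesis
      using finite_imp_finitely_generated_monoid comm_monoid.axioms(1) by blast
  qed
  ultimately show ?thesis by blast
qed

end
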